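(* Let $(x_i,y_i)_{i=1}^n$ be $n$ independent observations from the signal-plus-noise model $y=f(x)+\epsilon$, $f(x)=\mathbb E(y\mid x)$, where $x$ is a random covariate valued in $\mathscr X$. Assume that $\mathbb E[f(x)]=0$, $\mathbb E[f^2(x)]=\sigma_\mu^2$, $\mathbb E[f^4(x)]<\infty$, $\mathbb E(\epsilon)=0$, $\mathbb E(\epsilon^2)=\sigma_\epsilon^2$, and that $\epsilon$ is independent of $x$. Suppose further that, for a fixed $\delta>0$ with $\delta<\alpha(1-\alpha)/4$, there exist an estimator $\hat f:\mathscr X\times(\mathscr X\times\mathbb R)^n\times\Pi_n\to\mathbb R$ and a sequence $\ell_n$ (possibly depending on $\delta$) such that (i) for any $\pi\in\Pi_n$, $\hat f(x_i;(x_j,y_j)_{j=1}^n;\pi)=\hat f(x_i;(x_j,y_{\pi(j)})_{j=1}^n;\pi_0)$; (ii) for $n$ sufficiently large, $$\min_{\pi\in\tilde\Pi_n\cup\{\pi_0\}}\mathbb P\Big\{\sum_{i=1}^n[\hat f(x_i;(x_j,y_j)_{j=1}^n;\pi)-f_\pi(x_i)]^2\le\ell_n\Big\}\ge1-\delta.$$ Consider testing $H_0: f\equiv0$ against $$H_1:\ f\not\equiv0,\quad f\in\mathscr F,\quad \sigma_\mu^2=h\Big(\frac1{\sqrt n}+\frac{\ell_n}{n}\Big),$$ where $h>0$. If $h$ is sufficiently large (not depending on $n$), then, under the alternative hypothesis $H_1$, $$\liminf_{n\to\infty}\mathbb P_{H_1}(\phi(\hat f)\le\alpha)>\alpha.$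$
   Context: $\alpha\in(0,1)$ is the level of the test and $\mathscr F$ is a prespecified class of functions on $\mathscr X$. $\Pi_n$ is the set of all permutations of $\{1,\dots,n\}$, $\pi_0$ is the identity permutation, $K(\pi)$ is the number of cycles of $\pi$ (fixed points count as cycles), and $\tilde\Pi_n=\{\pi\in\Pi_n:K(\pi)\le\log^2(n)\}$. For $\pi\in\Pi_n$, $f_\pi(x_i):=\mathbb E(y_{\pi(i)}\mid x_i)$ (so $f_\pi(x_i)=0$ if $\pi(i)\ne i$, and $f_\pi(x_i)=f(x_i)$ if $\pi(i)=i$). Set $\hat f_\pi(\cdot)=\hat f(\cdot;(x_j,y_j)_{j=1}^n;\pi)$ and $\Lambda^{(\pi)}(\hat f)=\sum_{i=1}^n[\hat f_\pi(x_i)]^2$. The permutation p-value is $\phi(\hat f)=\frac1{|\Pi_n|}\sum_{\pi\in\Pi_n}\mathbf 1\{\Lambda^{(\pi_0)}(\hat f)\le\Lambda^{(\pi)}(\hat f)\}$.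
   Formalization: Since f may change with n, the assumption E[f^4(x)]<∞ is strengthened to a bound E[f^4(x)]≤C with C not depending on n, and the threshold for h may depend on C; with mere finiteness for each n the claim is false. *)

theory Defs
  imports "HOL-Probability.Probability" "HOL-Combinatorics.Combinatorics"
begin

subsection \<open>Permutations\<close>

definition perms :: "nat \<Rightarrow> (nat \<Rightarrow> nat) set" where
  "perms n = {\<pi>. \<pi> permutes {1..n}}"

text \<open>Cycles are counted as orbits on \<open>{1..n}\<close>, so every fixed point contributes one cycle.\<close>

definition num_cycles :: "nat \<Rightarrow> (nat \<Rightarrow> nat) \<Rightarrow> nat" where
  "num_cycles n \<pi> = card (orbit \<pi> ` {1..n})"

text \<open>The threshold is the square of the natural logarithm.\<close>

definition few_cycle_perms :: "nat \<Rightarrow> (nat \<Rightarrow> nat) set" where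
  "few_cycle_perms n = {\<pi> \<in> perms n. real (num_cycles n \<pi>) \<le> (ln (real n))\<^sup>2}"

subsection \<open>The signal-plus-noise model\<close>

text \<open>
  The \<open>n\<close> observations \<open>(x i, y i)\<close>, \<open>1 \<le> i \<le> n\<close>, are i.i.d. The independence of
  the noise and the covariate is that of the generated \<open>\<sigma>\<close>-algebras; \<^const>\<open>prob_space.indep_var\<close>
  cannot be used because it requires both variables to have values in the same type.
  Since the Bochner integral of a non-integrable function is \<open>0\<close>, finiteness of the
  moments is assumed explicitly; the lower moments are then finite as well.
\<close>

locale signal_plus_noise = prob_space M
  for M :: "'w measure" +
  fixes S :: "'x measure"
    and n :: nat
    and x :: "nat \<Rightarrow> 'w \<Rightarrow> 'x"
    and y :: "nat \<Rightarrow> 'w \<Rightarrow> real"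
    and eps :: "nat \<Rightarrow> 'w \<Rightarrow> real"
    and f :: "'x \<Rightarrow> real"
    and \<sigma>\<^sub>\<mu> :: real
    and \<sigma>\<^sub>\<epsilon> :: real
  assumes f_measurable: "f \<in> borel_measurable S"
    and x_rv: "i \<in> {1..n} \<Longrightarrow> random_variable S (x i)"
    and eps_rv: "i \<in> {1..n} \<Longrightarrow> random_variable borel (eps i)"
    and model: "i \<in> {1..n} \<Longrightarrow> \<omega> \<in> space M \<Longrightarrow> y i \<omega> = f (x i \<omega>) + eps i \<omega>"
    and regression: "i \<in> {1..n} \<Longrightarrow>
      AE \<omega> in M. real_cond_exp M (vimage_algebra (space M) (x i) S) (y i) \<omega> = f (x i \<omega>)"
    and observations_indep:
      "indep_vars (\<lambda>_. S \<Otimes>\<^sub>M borel) (\<lambda>i \<omega>. (x i \<omega>, y i \<omega>)) {1..n}"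
    and observations_ident: "i \<in> {1..n} \<Longrightarrow> j \<in> {1..n} \<Longrightarrow>
      distr M (S \<Otimes>\<^sub>M borel) (\<lambda>\<omega>. (x i \<omega>, y i \<omega>)) = distr M (S \<Otimes>\<^sub>M borel) (\<lambda>\<omega>. (x j \<omega>, y j \<omega>))"
    and noise_indep: "i \<in> {1..n} \<Longrightarrow>
      indep_set (sets (vimage_algebra (space M) (x i) S))
                (sets (vimage_algebra (space M) (eps i) borel))"
    and signal_mean: "i \<in> {1..n} \<Longrightarrow> expectation (\<lambda>\<omega>. f (x i \<omega>)) = 0"
    and signal_var: "i \<in> {1..n} \<Longrightarrow> expectation (\<lambda>\<omega>. (f (x i \<omega>))\<^sup>2) = \<sigma>\<^sub>\<mu>\<^sup>2"
    and signal_fourth: "i \<in> {1..n} \<Longrightarrow> integrable M (\<lambda>\<omega>. (f (x i \<omega>)) ^ 4)"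
    and noise_mean: "i \<in> {1..n} \<Longrightarrow> expectation (eps i) = 0"
    and noise_integrable: "i \<in> {1..n} \<Longrightarrow> integrable M (\<lambda>\<omega>. (eps i \<omega>)\<^sup>2)"
    and noise_var: "i \<in> {1..n} \<Longrightarrow> expectation (\<lambda>\<omega>. (eps i \<omega>)\<^sup>2) = \<sigma>\<^sub>\<epsilon>\<^sup>2"

text \<open>The random variable \<open>f\<^sub>\<pi>(x\<^sub>i) = E(y\<^bsub>\<pi>(i)\<^esub> | x\<^sub>i)\<close>.\<close>

definition f_perm ::
  "'w measure \<Rightarrow> 'x measure \<Rightarrow> (nat \<Rightarrow> 'w \<Rightarrow> 'x) \<Rightarrow> (nat \<Rightarrow> 'w \<Rightarrow> real) \<Rightarrow> (nat \<Rightarrow> nat) \<Rightarrow> nat \<Rightarrow> 'w \<Rightarrow> real"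
  where
  "f_perm M S x y \<pi> i = real_cond_exp M (vimage_algebra (space M) (x i) S) (y (\<pi> i))"

subsection \<open>Data sets and estimators\<close>

text \<open>
  A data set of size \<open>n\<close> is an extensional function on \<open>{1..n}\<close>. An estimator at
  sample size \<open>n\<close> maps an evaluation point, a data set and a permutation to a real number.
\<close>

type_synonym 'x dataset = "nat \<Rightarrow> 'x \<times> real"
type_synonym 'x estimator = "'x \<Rightarrow> 'x dataset \<Rightarrow> (nat \<Rightarrow> nat) \<Rightarrow> real"

definition sample :: "nat \<Rightarrow> (nat \<Rightarrow> 'w \<Rightarrow> 'x) \<Rightarrow> (nat \<Rightarrow> 'w \<Rightarrow> real) \<Rightarrow> 'w \<Rightarrow> 'x dataset" where
  "sample n x y \<omega> = (\<lambda>j\<in>{1..n}. (x j \<omega>, y j \<omega>))"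

definition permute_responses :: "nat \<Rightarrow> (nat \<Rightarrow> nat) \<Rightarrow> 'x dataset \<Rightarrow> 'x dataset" where
  "permute_responses n \<pi> D = (\<lambda>j\<in>{1..n}. (fst (D j), snd (D (\<pi> j))))"

definition dataset_space :: "'x measure \<Rightarrow> nat \<Rightarrow> 'x dataset measure" where
  "dataset_space S n = (\<Pi>\<^sub>M j\<in>{1..n}. S \<Otimes>\<^sub>M borel)"

definition measurable_estimator :: "'x measure \<Rightarrow> nat \<Rightarrow> 'x estimator \<Rightarrow> bool" where
  "measurable_estimator S n fhat \<longleftrightarrow>
     (\<forall>\<pi>\<in>perms n. (\<lambda>(z, D). fhat z D \<pi>) \<in> borel_measurable (S \<Otimes>\<^sub>M dataset_space S n))"

definition permutation_compatible :: "'x measure \<Rightarrow> nat \<Rightarrow> 'x estimator \<Rightarrow> bool" where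
  "permutation_compatible S n fhat \<longleftrightarrow>
     (\<forall>\<pi>\<in>perms n. \<forall>D\<in>space (dataset_space S n). \<forall>i\<in>{1..n}.
        fhat (fst (D i)) D \<pi> = fhat (fst (D i)) (permute_responses n \<pi> D) id)"

subsection \<open>The permutation test\<close>

definition test_stat :: "nat \<Rightarrow> 'x estimator \<Rightarrow> 'x dataset \<Rightarrow> (nat \<Rightarrow> nat) \<Rightarrow> real" where
  "test_stat n fhat D \<pi> = (\<Sum>i=1..n. (fhat (fst (D i)) D \<pi>)\<^sup>2)"

definition perm_pvalue :: "nat \<Rightarrow> 'x estimator \<Rightarrow> 'x dataset \<Rightarrow> real" where
  "perm_pvalue n fhat D =
     (\<Sum>\<pi>\<in>perms n. of_bool (test_stat n fhat D id \<le> test_stat n fhat D \<pi>)) / real (card (perms n))"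

end

theory Submission
  imports Defs "HOL-Real_Asymp.Real_Asymp"
begin

text \<open>
  Write \<open>\<Lambda>\<^sub>\<pi>\<close> for the test statistic of \<open>\<pi>\<close>. It is the squared Euclidean norm of the fitted
  values, and these lie within \<open>\<surd>l\<^sub>n\<close> of the vector \<open>f\<^sub>\<pi>\<close> with probability at least
  \<open>1 - \<delta>\<close> if \<open>\<pi>\<close> is the identity or has few cycles. The target vectors of the
  identity and of a typical permutation have very different norms.

  For the identity, \<open>\<parallel>f\<parallel>\<^sup>2 = \<Sum> f(x\<^sub>i)\<^sup>2\<close> has mean \<open>T = n \<sigma>\<^sub>\<mu>\<^sup>2 = h (\<surd>n + l\<^sub>n)\<close> and variance at most
  \<open>n C\<close>, so Chebyshev's inequality gives \<open>\<parallel>f\<parallel>\<^sup>2 > T/2\<close> except with probability \<open>4 n C / T\<^sup>2 \<le> 4 C / h\<^sup>2\<close>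
  (\<open>total_energy_lower_tail\<close>). For another permutation only the fixed points survive in \<open>f\<^sub>\<pi>\<close>,
  because \<open>y\<^sub>j\<close> is centred and independent of \<open>x\<^sub>i\<close> when \<open>j \<noteq> i\<close>. A fixed point is a cycle, so the mean of
  \<open>\<parallel>f\<^sub>\<pi>\<parallel>\<^sup>2\<close> is at most \<open>K(\<pi>) \<sigma>\<^sub>\<mu>\<^sup>2\<close>, and Markov's inequality gives \<open>\<parallel>f\<^sub>\<pi>\<parallel>\<^sup>2 < T/8\<close>
  except with probability \<open>8 K(\<pi>) / n\<close> (\<open>fixed_point_energy_upper_tail\<close>), which
  vanishes when \<open>K(\<pi>) \<le> ln\<^sup>2 n\<close>. Once \<open>T \<ge> 32 l\<^sub>n\<close>, the triangle inequality
  separates the two fits (\<open>energy_separation\<close>), hence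
  \<open>P(\<Lambda>\<^sub>i\<^sub>d \<le> \<Lambda>\<^sub>\<pi>) \<le> 2 \<delta> + 4 C / h\<^sup>2 + o(1)\<close> for every permutation with few cycles.

  Permutations with many cycles are rare: a uniform permutation has at most
  \<open>1 + 1/2 + \<dots> + 1/n\<close> cycles on average (\<open>sum_num_cycles_le\<close>), so by Markov a fraction
  of order at most \<open>1 / ln n\<close> has more than \<open>ln\<^sup>2 n\<close> cycles. Averaging over all permutations
  gives \<open>E \<phi> \<le> 2 \<delta> + 4 C / h\<^sup>2 + o(1)\<close>, and a last application of Markov's inequality bounds
  \<open>P(\<phi> > \<alpha>)\<close> by \<open>E \<phi> / \<alpha>\<close> (\<open>permutation_test_power_ge\<close>). Since \<open>2 \<delta> < \<alpha> (1 - \<alpha>) / 2\<close>, a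
  large \<open>h\<close> keeps this below \<open>7/8 (1 - \<alpha>)\<close>, so the power stays above \<open>\<alpha>\<close> by a margin.
\<close>

section \<open>The number of cycles of a random permutation\<close>

lemma permutes_orbit_mem:
  assumes "p permutes A" "finite A"
  shows "i \<in> orbit p i"
  using assms by (intro permutation_self_in_orbit) (auto simp: permutation_permutes)

lemma transpose_comp_permutes_insert:
  assumes "p permutes A" "b \<in> A"
  shows "Transposition.transpose a b \<circ> p permutes insert a A"
  using assms
  by (intro permutes_compose[OF permutes_imp_permutes_insert permutes_swap_id]) auto

text \<open>
  Composing with the transposition of a new point \<open>a\<close> and an old point \<open>b\<close> inserts \<open>a\<close> into the cycle of
  \<open>b\<close>, just before \<open>b\<close>: a step of \<open>p\<close> into \<open>b\<close> becomes two steps through \<open>a\<close>, and every other step is unchanged.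
\<close>

lemma orbit_insert_subset:
  assumes p: "p permutes A" and A: "finite A" "a \<notin> A" and b: "b \<in> A"
  shows "orbit p i \<subseteq> orbit (Transposition.transpose a b \<circ> p) i"
proof -
  let ?q = "Transposition.transpose a b \<circ> p"
  have pa: "p a = a"
    using p A by (simp add: permutes_not_in)
  have orbit_step_in: "p j \<in> orbit ?q j" for j
  proof (cases "p j = b")
    case True
    have "a \<in> orbit ?q j"
      using True by (intro orbit_eqI(1)) simp
    then show ?thesis
      using True pa orbit_eqI(2)[of "p j" ?q a j] by simp
  next
    case False
    show ?thesis
    proof (cases "j = a")
      case True
      have "?q permutes insert a A"
        using p b by (rule transpose_comp_permutes_insert)
      then show ?thesis
        using True pa A permutes_orbit_mem[of ?q "insert a A" a] by simp
    next
      case neq: False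
      then have "p j \<noteq> a"
        using inj_eq[OF permutes_inj[OF p], of j a] pa by simp
      with False show ?thesis
        by (intro orbit_eqI(1)) simp
    qed
  qed
  have "k \<in> orbit ?q i" if "k \<in> orbit p i" for k
    using that
  proof induction
    case base
    show ?case by (rule orbit_step_in)
  next
    case (step k)
    show ?case using orbit_step_in step.IH by (rule orbit_trans)
  qed
  then show ?thesis by blast
qed

text \<open>
  Old orbits can only grow and the new point joins one of them, so the insertion creates no new orbit.
\<close>

lemma card_orbits_insert_le:
  assumes p: "p permutes A" and A: "finite A" "a \<notin> A" and b: "b \<in> A"
  shows "card (orbit (Transposition.transpose a b \<circ> p) ` insert a A) \<le> card (orbit p ` A)"
proof -
  let ?q = "Transposition.transpose a b \<circ> p"
  have q: "?q permutes insert a A"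
    using p b by (rule transpose_comp_permutes_insert)
  then have cyc: "cyclic_on ?q (orbit ?q i)" for i
    using cyclic_on_orbit[of ?q "insert a A"] A by simp
  have eq: "orbit ?q j = orbit ?q i" if "j \<in> orbit ?q i" for i j
    using orbit_cyclic_eq3[OF cyc that] .
  have merge: "orbit ?q i = orbit ?q j" if "orbit p i = orbit p j" for i j
  proof -
    have "j \<in> orbit p i"
      using permutes_orbit_mem[OF p A(1)] that by simp
    then have "j \<in> orbit ?q i"
      using orbit_insert_subset[OF p A b] by blast
    then show ?thesis
      by (rule eq[symmetric])
  qed
  have "orbit ?q a \<in> orbit ?q ` A"
  proof -
    have "b \<in> p ` A"
      using permutes_image[OF p] b by simp
    then obtain i where i: "i \<in> A" "p i = b"
      by blast
    then have "a \<in> orbit ?q i"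
      by (intro orbit_eqI(1)) simp
    then have "orbit ?q a = orbit ?q i"
      by (rule eq)
    with i show ?thesis by blast
  qed
  then have "orbit ?q ` insert a A = orbit ?q ` A"
    by blast
  \<comment> \<open>By \<open>merge\<close>, the new orbit of a point depends only on its old orbit.\<close>
  also have "\<dots> = (\<lambda>c. orbit ?q (SOME i. orbit p i = c)) ` orbit p ` A"
  proof -
    have "orbit ?q j = orbit ?q (SOME i. orbit p i = orbit p j)" for j
      by (rule merge) (rule sym, rule someI[of _ j], rule refl)
    then show ?thesis
      unfolding image_image by (intro image_cong refl)
  qed
  finally show ?thesis
    using A by (simp add: card_image_le)
qed

text \<open>
  The expected number of cycles of a uniform permutation is in fact equal to the harmonic number.
  Every permutation of \<open>{1..n + 1}\<close> arises from exactly one of \<open>{1..n}\<close>, either by adding \<open>n + 1\<close> as a fixed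
  point, which costs one more cycle, or by one of \<open>n\<close> insertions into an existing cycle, which cost none.
  The mean therefore rises by at most \<open>1/(n + 1)\<close>.
\<close>

lemma sum_num_cycles_le:
  "(\<Sum>\<pi>\<in>perms n. real (num_cycles n \<pi>)) \<le> fact n * harm n"
proof (induction n)
  case 0
  show ?case by (simp add: num_cycles_def harm_def)
next
  case (Suc n)
  let ?A = "{1..n}" and ?a = "Suc n"
  have ins: "{1..Suc n} = insert ?a ?A" by auto
  have card_perms: "card (perms n) = fact n"
    by (simp add: perms_def card_permutations)
  have new: "real (num_cycles (Suc n) \<pi>) \<le> real (num_cycles n \<pi>) + 1" for \<pi>
    unfolding num_cycles_def ins by (simp add: card_insert_if)
  have old: "real (num_cycles (Suc n) (Transposition.transpose ?a b \<circ> \<pi>)) \<le> real (num_cycles n \<pi>)"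
    if "b \<in> ?A" "\<pi> \<in> perms n" for b \<pi>
    using card_orbits_insert_le[of \<pi> ?A ?a b] that
    unfolding num_cycles_def ins perms_def by simp
  have "(\<Sum>\<pi>\<in>perms (Suc n). real (num_cycles (Suc n) \<pi>)) =
      (\<Sum>b\<in>insert ?a ?A. \<Sum>\<pi>\<in>perms n. real (num_cycles (Suc n) (Transposition.transpose ?a b \<circ> \<pi>)))"
    unfolding perms_def ins by (rule sum_over_permutations_insert) auto
  also have "\<dots> = (\<Sum>\<pi>\<in>perms n. real (num_cycles (Suc n) \<pi>)) +
      (\<Sum>b\<in>?A. \<Sum>\<pi>\<in>perms n. real (num_cycles (Suc n) (Transposition.transpose ?a b \<circ> \<pi>)))"
    by simp
  also have "\<dots> \<le> (\<Sum>\<pi>\<in>perms n. real (num_cycles n \<pi>) + 1) +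
      (\<Sum>b\<in>?A. \<Sum>\<pi>\<in>perms n. real (num_cycles n \<pi>))"
    by (intro add_mono sum_mono new old)
  also have "\<dots> = (real n + 1) * (\<Sum>\<pi>\<in>perms n. real (num_cycles n \<pi>)) + fact n"
    by (simp add: sum.distrib card_perms algebra_simps)
  also have "\<dots> \<le> (real n + 1) * (fact n * harm n) + fact n"
    using Suc by (intro add_mono mult_left_mono) auto
  also have "\<dots> = fact (Suc n) * harm (Suc n)"
    by (simp add: harm_Suc field_simps)
  finally show ?case .
qed

text \<open>
  Markov's inequality for the number of cycles under the uniform distribution on permutations.
\<close>

lemma many_cycles_fraction_le:
  assumes "n \<ge> 2"
  shows "real (card (perms n - few_cycle_perms n)) / fact n \<le> harm n / (ln (real n))\<^sup>2"
proof -
  have fin: "finite (perms n)"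
    by (simp add: perms_def finite_permutations)
  have "real (card (perms n - few_cycle_perms n)) * (ln (real n))\<^sup>2 =
      (\<Sum>\<pi>\<in>perms n - few_cycle_perms n. (ln (real n))\<^sup>2)"
    by simp
  also have "\<dots> \<le> (\<Sum>\<pi>\<in>perms n - few_cycle_perms n. real (num_cycles n \<pi>))"
    by (intro sum_mono) (auto simp: few_cycle_perms_def)
  also have "\<dots> \<le> (\<Sum>\<pi>\<in>perms n. real (num_cycles n \<pi>))"
    using fin by (intro sum_mono2) auto
  also have "\<dots> \<le> fact n * harm n"
    by (rule sum_num_cycles_le)
  finally show ?thesis
    using assms by (simp add: field_simps)
qed

lemma harm_over_ln_squared_tendsto_0:
  "(\<lambda>n. harm n / (ln (real n))\<^sup>2) \<longlonglongrightarrow> (0 :: real)"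
proof (rule tendsto_sandwich[OF _ _ tendsto_const])
  show "\<forall>\<^sub>F n in sequentially. (0 :: real) \<le> harm n / (ln (real n))\<^sup>2"
    by (simp add: harm_nonneg)
  show "\<forall>\<^sub>F n in sequentially. harm n / (ln (real n))\<^sup>2 \<le> (1 + ln (real n)) / (ln (real n))\<^sup>2"
    using eventually_gt_at_top[of 0]
  proof eventually_elim
    case (elim n)
    then show ?case
      using euler_mascheroni_sequence_decreasing[of 1 n] by (intro divide_right_mono) (auto simp: harm_def)
  qed
  show "(\<lambda>n. (1 + ln (real n)) / (ln (real n))\<^sup>2) \<longlonglongrightarrow> 0"
    by real_asymp
qed

text \<open>
  Distinct fixed points have distinct singleton orbits.
\<close>

lemma card_fixed_points_le_num_cycles:
  "card {i\<in>{1..n}. \<pi> i = i} \<le> num_cycles n \<pi>"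
proof -
  have "inj_on (orbit \<pi>) {i\<in>{1..n}. \<pi> i = i}"
    by (auto intro!: inj_onI simp: orbit_eq_singleton_iff[THEN iffD2])
  then have "card {i\<in>{1..n}. \<pi> i = i} = card (orbit \<pi> ` {i\<in>{1..n}. \<pi> i = i})"
    by (simp add: card_image)
  also have "\<dots> \<le> num_cycles n \<pi>"
    unfolding num_cycles_def by (intro card_mono) auto
  finally show ?thesis .
qed

section \<open>The energy of the regression vectors\<close>

text \<open>
  Cross terms of independent variables factor and cancel against the squared mean, and each remaining
  variance is bounded by a second moment.
\<close>

lemma (in prob_space)
  fixes Z :: "'i \<Rightarrow> 'a \<Rightarrow> real"
  assumes I: "finite I"
    and indep: "indep_vars (\<lambda>_. borel) Z I"
    and sq: "\<And>i. i \<in> I \<Longrightarrow> integrable M (\<lambda>\<omega>. (Z i \<omega>)\<^sup>2)"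
  shows sum_square_integrable_indep: "integrable M (\<lambda>\<omega>. (\<Sum>i\<in>I. Z i \<omega>)\<^sup>2)"
    and variance_sum_indep_le:
      "variance (\<lambda>\<omega>. \<Sum>i\<in>I. Z i \<omega>) \<le> (\<Sum>i\<in>I. expectation (\<lambda>\<omega>. (Z i \<omega>)\<^sup>2))"
proof -
  have rv[measurable]: "random_variable borel (Z i)" if "i \<in> I" for i
    using indep that unfolding indep_vars_def by blast
  have int: "integrable M (Z i)" if "i \<in> I" for i
    using square_integrable_imp_integrable[OF rv sq] that by blast
  have pair: "integrable M (\<lambda>\<omega>. Z i \<omega> * Z j \<omega>) \<and>
      expectation (\<lambda>\<omega>. Z i \<omega> * Z j \<omega>) = expectation (Z i) * expectation (Z j)"
    if "i \<in> I" "j \<in> I" "i \<noteq> j" for i j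
  proof -
    have "indep_vars (\<lambda>_. borel) Z {i, j}"
      using that by (intro indep_vars_subset[OF indep]) auto
    then show ?thesis
      using indep_vars_integrable[of "{i, j}" Z] indep_vars_lebesgue_integral[of "{i, j}" Z] int that
      by auto
  qed
  have int2: "integrable M (\<lambda>\<omega>. Z i \<omega> * Z j \<omega>)" if "i \<in> I" "j \<in> I" for i j
    using pair[OF that] sq[OF that(1)] by (cases "i = j") (auto simp: power2_eq_square)
  show sum2: "integrable M (\<lambda>\<omega>. (\<Sum>i\<in>I. Z i \<omega>)\<^sup>2)"
    using int2 by (simp add: power2_eq_square sum_product)
  have "variance (\<lambda>\<omega>. \<Sum>i\<in>I. Z i \<omega>) =
      expectation (\<lambda>\<omega>. (\<Sum>i\<in>I. Z i \<omega>)\<^sup>2) - (expectation (\<lambda>\<omega>. \<Sum>i\<in>I. Z i \<omega>))\<^sup>2"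
    using int sum2 by (intro variance_eq) auto
  also have "\<dots> = (\<Sum>i\<in>I. \<Sum>j\<in>I. expectation (\<lambda>\<omega>. Z i \<omega> * Z j \<omega>)) -
      (\<Sum>i\<in>I. \<Sum>j\<in>I. expectation (Z i) * expectation (Z j))"
    using int int2 by (simp add: power2_eq_square sum_product)
  also have "\<dots> = (\<Sum>i\<in>I. \<Sum>j\<in>I.
      expectation (\<lambda>\<omega>. Z i \<omega> * Z j \<omega>) - expectation (Z i) * expectation (Z j))"
    by (simp add: sum_subtractf)
  also have "\<dots> \<le> (\<Sum>i\<in>I. \<Sum>j\<in>I. if i = j then expectation (\<lambda>\<omega>. (Z i \<omega>)\<^sup>2) else 0)"
    by (intro sum_mono) (auto simp: pair power2_eq_square)
  also have "\<dots> = (\<Sum>i\<in>I. expectation (\<lambda>\<omega>. (Z i \<omega>)\<^sup>2))"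
    using I by simp
  finally show "variance (\<lambda>\<omega>. \<Sum>i\<in>I. Z i \<omega>) \<le> (\<Sum>i\<in>I. expectation (\<lambda>\<omega>. (Z i \<omega>)\<^sup>2))" .
qed

context signal_plus_noise
begin

lemma observation_rv[measurable]:
  "i \<in> {1..n} \<Longrightarrow> random_variable (S \<Otimes>\<^sub>M borel) (\<lambda>\<omega>. (x i \<omega>, y i \<omega>))"
  using observations_indep unfolding indep_vars_def by blast

lemma signal_rv[measurable]: "i \<in> {1..n} \<Longrightarrow> random_variable borel (\<lambda>\<omega>. f (x i \<omega>))"
  using measurable_compose[OF x_rv f_measurable] .

lemma signal_square_integrable:
  assumes i: "i \<in> {1..n}"
  shows "integrable M (\<lambda>\<omega>. (f (x i \<omega>))\<^sup>2)"
proof (rule square_integrable_imp_integrable)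
  show "integrable M (\<lambda>\<omega>. ((f (x i \<omega>))\<^sup>2)\<^sup>2)"
    using signal_fourth[OF i] by simp
qed (use i in measurable)

lemma response_integrable:
  assumes i: "i \<in> {1..n}"
  shows "integrable M (y i)" and "expectation (y i) = 0"
proof -
  have f: "integrable M (\<lambda>\<omega>. f (x i \<omega>))"
    using square_integrable_imp_integrable[OF signal_rv signal_square_integrable] i by blast
  have e: "integrable M (eps i)"
    using square_integrable_imp_integrable[OF eps_rv noise_integrable] i by blast
  have "integrable M (y i) \<longleftrightarrow> integrable M (\<lambda>\<omega>. f (x i \<omega>) + eps i \<omega>)"
    using model[OF i] by (intro Bochner_Integration.integrable_cong) auto
  then show "integrable M (y i)"
    using f e by simp
  have "expectation (y i) = expectation (\<lambda>\<omega>. f (x i \<omega>) + eps i \<omega>)"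
    using model[OF i] by (intro Bochner_Integration.integral_cong) auto
  then show "expectation (y i) = 0"
    using f e signal_mean[OF i] noise_mean[OF i] by simp
qed

lemma covariate_subalgebra:
  assumes i: "i \<in> {1..n}"
  shows "subalgebra M (vimage_algebra (space M) (x i) S)"
  unfolding subalgebra_def
  using x_rv[OF i] by (auto simp: sets_vimage_algebra2 measurable_space dest: measurable_sets)

lemma f_perm_rv:
  assumes i: "i \<in> {1..n}"
  shows "random_variable borel (f_perm M S x y \<pi> i)"
  unfolding f_perm_def
  by (rule measurable_from_subalg[OF covariate_subalgebra[OF i] borel_measurable_cond_exp])

text \<open>
  A centred response of another observation is independent of \<open>x\<^sub>i\<close>, so its integral over every event
  determined by \<open>x\<^sub>i\<close> is zero. The two factors are written as functions of the
  observations \<open>i\<close> and \<open>\<pi> i\<close>, since independence is given for the pairs.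
\<close>

lemma f_perm_other:
  assumes i: "i \<in> {1..n}" and j: "\<pi> i \<in> {1..n}" and neq: "\<pi> i \<noteq> i"
  shows "AE \<omega> in M. f_perm M S x y \<pi> i \<omega> = 0"
proof -
  let ?F = "vimage_algebra (space M) (x i) S"
  interpret finite_measure_subalgebra M ?F
    by unfold_locales (rule covariate_subalgebra[OF i])
  show ?thesis
    unfolding f_perm_def
  proof (rule real_cond_exp_charact)
    fix A assume "A \<in> sets ?F"
    then obtain B where B: "B \<in> sets S" "A = x i -` B \<inter> space M"
      using x_rv[OF i] by (auto simp: sets_vimage_algebra2 measurable_space)
    let ?g = "\<lambda>k p. if k = i then indicator B (fst p) else snd p :: real"
    have g: "(\<lambda>p. ?g k p) \<in> borel_measurable (S \<Otimes>\<^sub>M borel)" for k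
      using B(1) by (cases "k = i") auto
    have indep: "indep_vars (\<lambda>_. borel) (\<lambda>k \<omega>. ?g k (x k \<omega>, y k \<omega>)) {i, \<pi> i}"
      using i j by (intro indep_vars_compose2[OF indep_vars_subset[OF observations_indep] g]) auto
    have A: "random_variable borel (\<lambda>\<omega>. indicator B (x i \<omega>) :: real)"
      using B(1) x_rv[OF i] by measurable
    have "expectation (\<lambda>\<omega>. \<Prod>k\<in>{i, \<pi> i}. ?g k (x k \<omega>, y k \<omega>)) =
        (\<Prod>k\<in>{i, \<pi> i}. expectation (\<lambda>\<omega>. ?g k (x k \<omega>, y k \<omega>)))"
    proof (rule indep_vars_lebesgue_integral[OF _ indep])
      fix k assume k: "k \<in> {i, \<pi> i}"
      show "integrable M (\<lambda>\<omega>. ?g k (x k \<omega>, y k \<omega>))"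
      proof (cases "k = i")
        case True
        have "integrable M (\<lambda>\<omega>. indicator B (x i \<omega>) :: real)"
          by (rule integrable_const_bound[OF _ A, of 1]) (auto simp: indicator_def)
        then show ?thesis using True by simp
      next
        case False
        then show ?thesis using k response_integrable(1)[OF j] by simp
      qed
    qed simp
    then have "expectation (\<lambda>\<omega>. indicator B (x i \<omega>) * y (\<pi> i) \<omega>) = 0"
      using neq response_integrable(2)[OF j] by simp
    moreover have "(LINT \<omega>:A|M. y (\<pi> i) \<omega>) = expectation (\<lambda>\<omega>. indicator B (x i \<omega>) * y (\<pi> i) \<omega>)"
      unfolding set_lebesgue_integral_def B(2)
      by (intro Bochner_Integration.integral_cong) (auto simp: indicator_def)
    ultimately show "(LINT \<omega>:A|M. y (\<pi> i) \<omega>) = (LINT \<omega>:A|M. 0)"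
      by simp
  qed (use response_integrable(1)[OF j] in simp_all)
qed

lemma f_perm_AE:
  assumes i: "i \<in> {1..n}" and \<pi>: "\<pi> permutes {1..n}"
  shows "AE \<omega> in M. f_perm M S x y \<pi> i \<omega> = (if \<pi> i = i then f (x i \<omega>) else 0)"
proof (cases "\<pi> i = i")
  case True
  then show ?thesis
    using regression[OF i] by (simp add: f_perm_def)
next
  case False
  then show ?thesis
    using f_perm_other[OF i] permutes_in_image[OF \<pi>] i by simp
qed

lemma f_perm_energy_AE:
  assumes \<pi>: "\<pi> permutes {1..n}"
  shows "AE \<omega> in M. (\<Sum>i=1..n. (f_perm M S x y \<pi> i \<omega>)\<^sup>2) = (\<Sum>i | i \<in> {1..n} \<and> \<pi> i = i. (f (x i \<omega>))\<^sup>2)"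
proof -
  have "AE \<omega> in M. \<forall>i\<in>{1..n}. f_perm M S x y \<pi> i \<omega> = (if \<pi> i = i then f (x i \<omega>) else 0)"
    using f_perm_AE[OF _ \<pi>] by (intro AE_finite_allI) auto
  then show ?thesis
  proof eventually_elim
    case (elim \<omega>)
    then have "(\<Sum>i=1..n. (f_perm M S x y \<pi> i \<omega>)\<^sup>2) =
        (\<Sum>i=1..n. if \<pi> i = i then (f (x i \<omega>))\<^sup>2 else 0)"
      by (intro sum.cong) auto
    also have "\<dots> = (\<Sum>i | i \<in> {1..n} \<and> \<pi> i = i. (f (x i \<omega>))\<^sup>2)"
      by (rule sum.inter_filter[symmetric]) simp
    finally show ?case .
  qed
qed

text \<open>
  Chebyshev's inequality: the energy has mean \<open>T\<close>, and the fourth moments of the signal bound its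
  variance by \<open>n C\<close>. Falling to half of the mean is a deviation of at least \<open>T/2\<close>.
\<close>

lemma total_energy_lower_tail:
  assumes fourth: "\<And>i. i \<in> {1..n} \<Longrightarrow> expectation (\<lambda>\<omega>. (f (x i \<omega>)) ^ 4) \<le> C"
    and T: "T = real n * \<sigma>\<^sub>\<mu>\<^sup>2" "0 < T"
  shows "prob {\<omega>\<in>space M. (\<Sum>i=1..n. (f_perm M S x y id i \<omega>)\<^sup>2) \<le> T / 2} \<le> 4 * real n * C / T\<^sup>2"
proof -
  let ?E = "\<lambda>\<omega>. \<Sum>i=1..n. (f (x i \<omega>))\<^sup>2"
  have [measurable]: "random_variable borel ?E"
    by measurable
  have [measurable]: "random_variable borel (\<lambda>\<omega>. \<Sum>i=1..n. (f_perm M S x y id i \<omega>)\<^sup>2)"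
    using f_perm_rv by (intro borel_measurable_sum borel_measurable_power) auto
  have indep: "indep_vars (\<lambda>_. borel) (\<lambda>i \<omega>. (f (x i \<omega>))\<^sup>2) {1..n}"
    using indep_vars_compose2[OF observations_indep, of "\<lambda>_ p. (f (fst p))\<^sup>2" "\<lambda>_. borel"] f_measurable
    by simp
  have fourth_int: "integrable M (\<lambda>\<omega>. ((f (x i \<omega>))\<^sup>2)\<^sup>2)" if "i \<in> {1..n}" for i
    using signal_fourth[OF that] by simp
  have mean: "expectation ?E = T"
    using signal_square_integrable signal_var T by simp
  have "variance ?E \<le> (\<Sum>i=1..n. expectation (\<lambda>\<omega>. ((f (x i \<omega>))\<^sup>2)\<^sup>2))"
    using fourth_int by (intro variance_sum_indep_le indep) auto
  also have "\<dots> \<le> (\<Sum>i=1..n. C)"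
    using fourth by (intro sum_mono) simp
  finally have var: "variance ?E \<le> real n * C"
    by simp
  have int2: "integrable M (\<lambda>\<omega>. (?E \<omega>)\<^sup>2)"
    using fourth_int by (intro sum_square_integrable_indep indep) auto
  have "{i. i \<in> {1..n} \<and> id i = i} = {1..n}"
    by auto
  then have energy: "AE \<omega> in M. (\<Sum>i=1..n. (f_perm M S x y id i \<omega>)\<^sup>2) = ?E \<omega>"
    using f_perm_energy_AE[OF permutes_id] by (simp only:)
  have "prob {\<omega>\<in>space M. (\<Sum>i=1..n. (f_perm M S x y id i \<omega>)\<^sup>2) \<le> T / 2} \<le>
      prob {\<omega>\<in>space M. \<bar>?E \<omega> - expectation ?E\<bar> \<ge> T / 2}"
    unfolding mean using energy T(2)
    by (intro finite_measure_mono_AE) (auto simp: abs_if elim!: eventually_mono)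
  also have "\<dots> \<le> variance ?E / (T / 2)\<^sup>2"
    using T int2 by (intro Chebyshev_inequality) auto
  also have "\<dots> \<le> real n * C / (T / 2)\<^sup>2"
    using var by (intro divide_right_mono) auto
  also have "\<dots> = 4 * real n * C / T\<^sup>2"
    by (simp add: power2_eq_square)
  finally show ?thesis .
qed

text \<open>
  Markov's inequality: each fixed point contributes mean energy \<open>\<sigma>\<^sub>\<mu>\<^sup>2\<close>, which is \<open>T/n\<close>.
\<close>

lemma fixed_point_energy_upper_tail:
  assumes \<pi>: "\<pi> permutes {1..n}" and T: "T = real n * \<sigma>\<^sub>\<mu>\<^sup>2" "0 < T"
  shows "prob {\<omega>\<in>space M. (\<Sum>i=1..n. (f_perm M S x y \<pi> i \<omega>)\<^sup>2) \<ge> T / 8} \<le>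
    8 * real (card {i\<in>{1..n}. \<pi> i = i}) / real n"
proof -
  let ?E = "\<lambda>\<omega>. \<Sum>i | i \<in> {1..n} \<and> \<pi> i = i. (f (x i \<omega>))\<^sup>2"
  have [measurable]: "random_variable borel (\<lambda>\<omega>. \<Sum>i=1..n. (f_perm M S x y \<pi> i \<omega>)\<^sup>2)"
    using f_perm_rv by (intro borel_measurable_sum borel_measurable_power) auto
  have int: "integrable M ?E"
    using signal_square_integrable by (intro Bochner_Integration.integrable_sum) auto
  have mean: "expectation ?E = real (card {i\<in>{1..n}. \<pi> i = i}) * \<sigma>\<^sub>\<mu>\<^sup>2"
    using signal_square_integrable signal_var by simp
  have "prob {\<omega>\<in>space M. (\<Sum>i=1..n. (f_perm M S x y \<pi> i \<omega>)\<^sup>2) \<ge> T / 8} \<le>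
      prob {\<omega>\<in>space M. ?E \<omega> \<ge> T / 8}"
    using f_perm_energy_AE[OF \<pi>] borel_measurable_integrable[OF int]
    by (intro finite_measure_mono_AE) (auto elim!: eventually_mono)
  also have "\<dots> \<le> expectation ?E / (T / 8)"
    using T by (intro integral_Markov_inequality_measure[OF int, of "{}"]) (auto intro!: sum_nonneg)
  also have "\<dots> = 8 * real (card {i\<in>{1..n}. \<pi> i = i}) / real n"
    unfolding mean using T by (auto simp: field_simps)
  finally show ?thesis .
qed

end

section \<open>Separation of the test statistics\<close>

text \<open>
  With \<open>r = \<surd>(T/8)\<close>, the targets satisfy \<open>\<parallel>u\<parallel> > 2 r\<close> and \<open>\<parallel>v\<parallel> < r\<close>, and the fitting errors are at most
  \<open>\<surd>l \<le> r/2\<close>. By the triangle inequality the norm \<open>3/2 r\<close> separates \<open>a\<close> from \<open>b\<close>.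
\<close>

lemma energy_separation:
  fixes a b u v :: "'i \<Rightarrow> real"
  assumes a: "(\<Sum>i\<in>I. (a i - u i)\<^sup>2) \<le> l" and b: "(\<Sum>i\<in>I. (b i - v i)\<^sup>2) \<le> l"
    and u: "T / 2 < (\<Sum>i\<in>I. (u i)\<^sup>2)" and v: "(\<Sum>i\<in>I. (v i)\<^sup>2) < T / 8"
    and l: "32 * l \<le> T"
  shows "(\<Sum>i\<in>I. (b i)\<^sup>2) < (\<Sum>i\<in>I. (a i)\<^sup>2)"
proof -
  define r where "r = sqrt (T / 8)"
  have "sqrt l \<le> sqrt ((T / 8) / 4)"
    using l by (intro real_sqrt_le_mono) simp
  also have "\<dots> = r / 2"
    unfolding r_def real_sqrt_divide[of _ 4] by simp
  finally have lr: "sqrt l \<le> r / 2" .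
  have "L2_set b I = L2_set (\<lambda>i. (b i - v i) + v i) I"
    by simp
  also have "\<dots> \<le> L2_set (\<lambda>i. b i - v i) I + L2_set v I"
    by (rule L2_set_triangle_ineq)
  also have "L2_set (\<lambda>i. b i - v i) I \<le> r / 2"
    using b lr unfolding L2_set_def by (meson order_trans real_sqrt_le_mono)
  also have "L2_set v I < r"
    using v unfolding L2_set_def r_def by (rule real_sqrt_less_mono)
  finally have "L2_set b I < 3 / 2 * r"
    by simp
  moreover have "3 / 2 * r < L2_set a I"
  proof -
    have "2 * r = sqrt 4 * sqrt (T / 8)"
      by (simp add: r_def)
    also have "\<dots> = sqrt (T / 2)"
      unfolding real_sqrt_mult[symmetric] by simp
    also have "\<dots> < L2_set u I"
      using u unfolding L2_set_def by (rule real_sqrt_less_mono)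
    also have "L2_set u I = L2_set (\<lambda>i. (u i - a i) + a i) I"
      by simp
    also have "\<dots> \<le> L2_set (\<lambda>i. u i - a i) I + L2_set a I"
      by (rule L2_set_triangle_ineq)
    also have "L2_set (\<lambda>i. u i - a i) I \<le> r / 2"
      using a lr unfolding L2_set_def power2_commute[of "u _"] by (meson order_trans real_sqrt_le_mono)
    finally show ?thesis
      by simp
  qed
  ultimately have "L2_set b I < L2_set a I"
    by simp
  then show ?thesis
    by (simp add: L2_set_def)
qed

context signal_plus_noise
begin

lemma sample_rv: "random_variable (dataset_space S n) (sample n x y)"
  unfolding sample_def[abs_def] dataset_space_def
  by (rule measurable_restrict) (rule observation_rv)

lemma fitted_value_rv:
  assumes "measurable_estimator S n fhat" "\<pi> \<in> perms n" "i \<in> {1..n}"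
  shows "random_variable borel (\<lambda>\<omega>. fhat (x i \<omega>) (sample n x y \<omega>) \<pi>)"
proof -
  have "(\<lambda>(z, D). fhat z D \<pi>) \<in> borel_measurable (S \<Otimes>\<^sub>M dataset_space S n)"
    using assms unfolding measurable_estimator_def by blast
  from measurable_compose[OF measurable_Pair[OF x_rv[OF assms(3)] sample_rv] this]
  show ?thesis by simp
qed

lemma test_stat_sample:
  "test_stat n fhat (sample n x y \<omega>) \<pi> = (\<Sum>i=1..n. (fhat (x i \<omega>) (sample n x y \<omega>) \<pi>)\<^sup>2)"
  unfolding test_stat_def by (intro sum.cong) (auto simp: sample_def)

lemma test_stat_rv:
  assumes "measurable_estimator S n fhat" "\<pi> \<in> perms n"
  shows "random_variable borel (\<lambda>\<omega>. test_stat n fhat (sample n x y \<omega>) \<pi>)"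
  unfolding test_stat_sample
  using fitted_value_rv[OF assms] by (intro borel_measurable_sum borel_measurable_power) auto

lemma id_in_perms: "id \<in> perms n"
  by (simp add: perms_def)

text \<open>
  The permuted statistic can reach the observed one only if one of the two fits is inaccurate,
  the full signal energy is at most \<open>T/2\<close>, or the energy at the fixed points is at least \<open>T/8\<close>. A union bound
  over these four events gives the result.
\<close>

lemma prob_permuted_stat_ge:
  assumes est: "measurable_estimator S n fhat" and \<pi>: "\<pi> \<in> perms n"
    and accurate: "\<And>\<tau>. \<tau> \<in> {id, \<pi>} \<Longrightarrow>
      1 - \<delta> \<le> prob {\<omega>\<in>space M. (\<Sum>i=1..n. (fhat (x i \<omega>) (sample n x y \<omega>) \<tau>
                                        - f_perm M S x y \<tau> i \<omega>)\<^sup>2) \<le> l}"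
    and fourth: "\<And>i. i \<in> {1..n} \<Longrightarrow> expectation (\<lambda>\<omega>. (f (x i \<omega>)) ^ 4) \<le> C"
    and T: "T = real n * \<sigma>\<^sub>\<mu>\<^sup>2" "0 < T" "32 * l \<le> T"
  shows "prob {\<omega>\<in>space M. test_stat n fhat (sample n x y \<omega>) id \<le> test_stat n fhat (sample n x y \<omega>) \<pi>}
    \<le> 2 * \<delta> + 4 * real n * C / T\<^sup>2 + 8 * real (num_cycles n \<pi>) / real n"
proof -
  define G where "G \<tau> = {\<omega>\<in>space M. (\<Sum>i=1..n. (fhat (x i \<omega>) (sample n x y \<omega>) \<tau>
                                        - f_perm M S x y \<tau> i \<omega>)\<^sup>2) \<le> l}" for \<tau>
  define U where "U = {\<omega>\<in>space M. (\<Sum>i=1..n. (f_perm M S x y id i \<omega>)\<^sup>2) \<le> T / 2}"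
  define V where "V = {\<omega>\<in>space M. (\<Sum>i=1..n. (f_perm M S x y \<pi> i \<omega>)\<^sup>2) \<ge> T / 8}"
  have E: "random_variable borel (\<lambda>\<omega>. \<Sum>i=1..n. (f_perm M S x y \<tau> i \<omega>)\<^sup>2)" for \<tau>
    using f_perm_rv by (intro borel_measurable_sum borel_measurable_power) auto
  have [measurable]: "U \<in> events" "V \<in> events"
    unfolding U_def V_def using E by measurable
  have G: "G \<tau> \<in> events \<and> prob (space M - G \<tau>) \<le> \<delta>" if "\<tau> \<in> {id, \<pi>}" for \<tau>
  proof -
    have "\<tau> \<in> perms n"
      using that \<pi> id_in_perms by blast
    then have "random_variable borel (\<lambda>\<omega>. \<Sum>i=1..n. (fhat (x i \<omega>) (sample n x y \<omega>) \<tau>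
                                        - f_perm M S x y \<tau> i \<omega>)\<^sup>2)"
      using fitted_value_rv[OF est] f_perm_rv
      by (intro borel_measurable_sum borel_measurable_power borel_measurable_diff) auto
    then have "G \<tau> \<in> events"
      unfolding G_def by measurable
    then show ?thesis
      using accurate[OF that] prob_compl[of "G \<tau>"] unfolding G_def by auto
  qed
  have [measurable]: "G id \<in> events" "G \<pi> \<in> events"
    using G by blast+
  have "{\<omega>\<in>space M. test_stat n fhat (sample n x y \<omega>) id \<le> test_stat n fhat (sample n x y \<omega>) \<pi>}
      \<subseteq> ((space M - G id) \<union> (space M - G \<pi>)) \<union> (U \<union> V)"
  proof (rule subsetI, rule ccontr)
    fix \<omega>
    assume le: "\<omega> \<in> {\<omega>\<in>space M. test_stat n fhat (sample n x y \<omega>) id \<le> test_stat n fhat (sample n x y \<omega>) \<pi>}"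
      and "\<omega> \<notin> ((space M - G id) \<union> (space M - G \<pi>)) \<union> (U \<union> V)"
    then have "test_stat n fhat (sample n x y \<omega>) \<pi> < test_stat n fhat (sample n x y \<omega>) id"
      unfolding test_stat_sample G_def U_def V_def
      by (intro energy_separation[where T = T and l = l
            and u = "\<lambda>i. f_perm M S x y id i \<omega>" and v = "\<lambda>i. f_perm M S x y \<pi> i \<omega>"])
         (use T in auto)
    with le show False by simp
  qed
  then have "prob {\<omega>\<in>space M. test_stat n fhat (sample n x y \<omega>) id \<le> test_stat n fhat (sample n x y \<omega>) \<pi>}
      \<le> prob (((space M - G id) \<union> (space M - G \<pi>)) \<union> (U \<union> V))"
    by (intro finite_measure_mono) measurable
  also have "\<dots> \<le> (prob (space M - G id) + prob (space M - G \<pi>)) + (prob U + prob V)"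
    by (intro order_trans[OF measure_Un_le] add_mono measure_Un_le) measurable
  also have "\<dots> \<le> (\<delta> + \<delta>) + (4 * real n * C / T\<^sup>2 + 8 * real (num_cycles n \<pi>) / real n)"
  proof (intro add_mono)
    show "prob U \<le> 4 * real n * C / T\<^sup>2"
      unfolding U_def by (rule total_energy_lower_tail[OF fourth T(1,2)])
    have "prob V \<le> 8 * real (card {i\<in>{1..n}. \<pi> i = i}) / real n"
      unfolding V_def using \<pi> T by (intro fixed_point_energy_upper_tail) (auto simp: perms_def)
    also have "\<dots> \<le> 8 * real (num_cycles n \<pi>) / real n"
      using card_fixed_points_le_num_cycles by (intro divide_right_mono) auto
    finally show "prob V \<le> 8 * real (num_cycles n \<pi>) / real n" .
  qed (use G in auto)
  finally show ?thesis by simp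
qed

text \<open>
  The mean of the p-value is the average over all permutations of the probability that the permuted
  statistic reaches the observed one, so Markov's inequality bounds the probability that the test
  does not reject.
\<close>

lemma prob_pvalue_le_ge:
  assumes est: "measurable_estimator S n fhat" and \<alpha>: "0 < \<alpha>"
  shows "1 - (\<Sum>\<pi>\<in>perms n. prob {\<omega>\<in>space M.
      test_stat n fhat (sample n x y \<omega>) id \<le> test_stat n fhat (sample n x y \<omega>) \<pi>}) / fact n / \<alpha>
    \<le> prob {\<omega>\<in>space M. perm_pvalue n fhat (sample n x y \<omega>) \<le> \<alpha>}"
proof -
  let ?A = "\<lambda>\<pi>. {\<omega>\<in>space M. test_stat n fhat (sample n x y \<omega>) id \<le> test_stat n fhat (sample n x y \<omega>) \<pi>}"
  let ?p = "\<lambda>\<omega>. perm_pvalue n fhat (sample n x y \<omega>)"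
  have A: "?A \<pi> \<in> events" if "\<pi> \<in> perms n" for \<pi>
    using test_stat_rv[OF est that] test_stat_rv[OF est id_in_perms] by measurable
  have card: "card (perms n) = fact n"
    by (simp add: perms_def card_permutations)
  have p: "?p \<omega> = (\<Sum>\<pi>\<in>perms n. indicator (?A \<pi>) \<omega>) / fact n" if "\<omega> \<in> space M" for \<omega>
    using that unfolding perm_pvalue_def card by (simp add: indicator_def of_bool_def)
  have int: "integrable M (\<lambda>\<omega>. (\<Sum>\<pi>\<in>perms n. indicator (?A \<pi>) \<omega>) / fact n :: real)"
    using A by (intro integrable_divide Bochner_Integration.integrable_sum)
      (auto simp: less_top[symmetric])
  then have p_int: "integrable M ?p"
    by (subst Bochner_Integration.integrable_cong[OF refl p]) auto
  have "expectation ?p = expectation (\<lambda>\<omega>. (\<Sum>\<pi>\<in>perms n. indicator (?A \<pi>) \<omega>) / fact n)"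
    by (intro Bochner_Integration.integral_cong refl p)
  also have "\<dots> = (\<Sum>\<pi>\<in>perms n. prob (?A \<pi>)) / fact n"
  proof -
    have "integrable M (indicator (?A \<pi>) :: 'w \<Rightarrow> real)" if "\<pi> \<in> perms n" for \<pi>
      using A[OF that] by (auto simp: less_top[symmetric])
    then show ?thesis
      using A by (simp add: Bochner_Integration.integral_sum Int_absorb2 sets.sets_into_space)
  qed
  finally have mean: "expectation ?p = (\<Sum>\<pi>\<in>perms n. prob (?A \<pi>)) / fact n" .
  have [measurable]: "random_variable borel ?p"
    using p_int by (rule borel_measurable_integrable)
  have "prob (space M - {\<omega>\<in>space M. ?p \<omega> \<le> \<alpha>}) \<le> prob {\<omega>\<in>space M. ?p \<omega> \<ge> \<alpha>}"
    by (intro finite_measure_mono) auto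
  also have "\<dots> \<le> expectation ?p / \<alpha>"
    using p_int \<alpha> by (intro integral_Markov_inequality_measure[of _ _ "{}"])
      (auto simp: perm_pvalue_def intro!: divide_nonneg_nonneg sum_nonneg)
  finally show ?thesis
    unfolding mean by (simp add: prob_compl)
qed

text \<open>
  The power bound at a fixed sample size. Permutations with few cycles are treated
  with \<open>prob_permuted_stat_ge\<close>; the others enter with the trivial bound \<open>1\<close>, which is affordable because
  they form a fraction of at most \<open>harm n / (ln n)\<^sup>2\<close>.
\<close>

theorem permutation_test_power_ge:
  assumes n: "2 \<le> n" and \<alpha>: "0 < \<alpha>" and \<delta>: "0 \<le> \<delta>" "\<delta> < 1" and h: "32 \<le> h"
    and est: "measurable_estimator S n fhat"
    and accurate: "\<And>\<pi>. \<pi> \<in> few_cycle_perms n \<union> {id} \<Longrightarrow>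
      1 - \<delta> \<le> prob {\<omega>\<in>space M. (\<Sum>i=1..n. (fhat (x i \<omega>) (sample n x y \<omega>) \<pi>
                                        - f_perm M S x y \<pi> i \<omega>)\<^sup>2) \<le> l}"
    and fourth: "\<And>i. i \<in> {1..n} \<Longrightarrow> expectation (\<lambda>\<omega>. (f (x i \<omega>)) ^ 4) \<le> C"
    and signal: "\<sigma>\<^sub>\<mu>\<^sup>2 = h * (1 / sqrt (real n) + l / real n)"
  shows "1 - (2 * \<delta> + 4 * C / h\<^sup>2 + 8 * (ln (real n))\<^sup>2 / real n + harm n / (ln (real n))\<^sup>2) / \<alpha>
    \<le> prob {\<omega>\<in>space M. perm_pvalue n fhat (sample n x y \<omega>) \<le> \<alpha>}"
proof -
  let ?A = "\<lambda>\<pi>. {\<omega>\<in>space M. test_stat n fhat (sample n x y \<omega>) id \<le> test_stat n fhat (sample n x y \<omega>) \<pi>}"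
  define T where "T = real n * \<sigma>\<^sub>\<mu>\<^sup>2"
  define B where "B = 2 * \<delta> + 4 * C / h\<^sup>2 + 8 * (ln (real n))\<^sup>2 / real n"
  let ?G = "{\<omega>\<in>space M. (\<Sum>i=1..n. (fhat (x i \<omega>) (sample n x y \<omega>) id
      - f_perm M S x y id i \<omega>)\<^sup>2) \<le> l}"
  \<comment> \<open>The radius is nonnegative because a sum of squares falls below it with positive probability.\<close>
  have "0 < prob ?G"
    using accurate[of id] \<delta> by auto
  then have "?G \<noteq> {}"
    by (metis measure_empty less_irrefl)
  then obtain \<omega> where "(\<Sum>i=1..n. (fhat (x i \<omega>) (sample n x y \<omega>) id - f_perm M S x y id i \<omega>)\<^sup>2) \<le> l"
    by blast
  then have l: "0 \<le> l"
    by (rule order_trans[rotated]) (intro sum_nonneg zero_le_power2)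
  have "0 \<le> expectation (\<lambda>\<omega>. (f (x 1 \<omega>)) ^ 4)"
    by (intro integral_nonneg_AE) auto
  also have "\<dots> \<le> C"
    using n by (intro fourth) auto
  finally have C: "0 \<le> C" .
  have Th: "T = h * (sqrt (real n) + l)"
    using n unfolding T_def signal by (simp add: field_simps flip: power2_eq_square)
  have hn: "h * sqrt (real n) \<le> T"
    unfolding Th using h l by (intro mult_left_mono) auto
  have hn0: "0 < h * sqrt (real n)"
    using h n by simp
  have T: "0 < T"
    using hn hn0 by linarith
  have "32 * l \<le> h * l"
    using h l by (intro mult_right_mono) auto
  also have "\<dots> \<le> T"
    unfolding Th using h by (intro mult_left_mono) auto
  finally have lT: "32 * l \<le> T" .
  have CT: "4 * real n * C / T\<^sup>2 \<le> 4 * C / h\<^sup>2"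
  proof -
    have "4 * real n * C / T\<^sup>2 \<le> 4 * real n * C / (h * sqrt (real n))\<^sup>2"
      using C hn hn0 T h n by (intro divide_left_mono power_mono mult_pos_pos zero_less_power) auto
    also have "\<dots> = 4 * C / h\<^sup>2"
      using n by (simp add: power_mult_distrib)
    finally show ?thesis .
  qed
  have few: "prob (?A \<pi>) \<le> B" if "\<pi> \<in> few_cycle_perms n" for \<pi>
  proof -
    have "prob (?A \<pi>) \<le> 2 * \<delta> + 4 * real n * C / T\<^sup>2 + 8 * real (num_cycles n \<pi>) / real n"
      using that T lT est fourth T_def accurate
      by (intro prob_permuted_stat_ge[where l = l]) (auto simp: few_cycle_perms_def)
    also have "\<dots> \<le> B"
      unfolding B_def using that CT by (intro add_mono divide_right_mono) (auto simp: few_cycle_perms_def)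
    finally show ?thesis .
  qed
  have fin: "finite (perms n)" and card: "card (perms n) = fact n"
    by (simp_all add: perms_def finite_permutations card_permutations)
  have B: "0 \<le> B"
    unfolding B_def using \<delta> C by (intro add_nonneg_nonneg) auto
  have sub: "few_cycle_perms n \<subseteq> perms n"
    by (auto simp: few_cycle_perms_def)
  have card_few: "real (card (few_cycle_perms n)) \<le> fact n"
    using of_nat_mono[OF card_mono[OF fin sub], where 'a = real] unfolding card of_nat_fact .
  have "(\<Sum>\<pi>\<in>perms n. prob (?A \<pi>)) =
      (\<Sum>\<pi>\<in>few_cycle_perms n. prob (?A \<pi>)) + (\<Sum>\<pi>\<in>perms n - few_cycle_perms n. prob (?A \<pi>))"
    using sum.subset_diff[OF sub fin] by (simp add: add.commute)
  also have "\<dots> \<le> (\<Sum>\<pi>\<in>few_cycle_perms n. B) + (\<Sum>\<pi>\<in>perms n - few_cycle_perms n. 1)"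
    by (intro add_mono sum_mono few prob_le_1)
  also have "\<dots> \<le> fact n * B + real (card (perms n - few_cycle_perms n))"
    using mult_right_mono[OF card_few B] by simp
  finally have "(\<Sum>\<pi>\<in>perms n. prob (?A \<pi>)) / fact n \<le>
      (fact n * B + real (card (perms n - few_cycle_perms n))) / fact n"
    by (intro divide_right_mono) auto
  also have "\<dots> = B + real (card (perms n - few_cycle_perms n)) / fact n"
    by (simp add: add_divide_distrib)
  also have "\<dots> \<le> B + harm n / (ln (real n))\<^sup>2"
    using many_cycles_fraction_le[OF n] by simp
  finally have "(\<Sum>\<pi>\<in>perms n. prob (?A \<pi>)) / fact n / \<alpha> \<le> (B + harm n / (ln (real n))\<^sup>2) / \<alpha>"
    using \<alpha> by (intro divide_right_mono) auto
  with prob_pvalue_le_ge[OF est \<alpha>] show ?thesis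
    unfolding B_def by linarith
qed

end

section \<open>Asymptotic power\<close>

theorem theorem4:
  fixes \<alpha> \<delta> \<sigma>\<^sub>\<epsilon> C :: real
    and S :: "'x measure"
    and \<F> :: "('x \<Rightarrow> real) set"
  assumes "0 < \<alpha>" "\<alpha> < 1"
    and "0 < \<delta>" "\<delta> < \<alpha> * (1 - \<alpha>) / 4"
  shows "\<exists>h\<^sub>0>0. \<forall>h\<ge>h\<^sub>0.
    \<forall>(M :: nat \<Rightarrow> 'w measure)
     (x :: nat \<Rightarrow> nat \<Rightarrow> 'w \<Rightarrow> 'x)
     (y :: nat \<Rightarrow> nat \<Rightarrow> 'w \<Rightarrow> real)
     (eps :: nat \<Rightarrow> nat \<Rightarrow> 'w \<Rightarrow> real)
     (f :: nat \<Rightarrow> 'x \<Rightarrow> real)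
     (\<sigma>\<^sub>\<mu> :: nat \<Rightarrow> real)
     (fhat :: nat \<Rightarrow> 'x estimator)
     (l :: nat \<Rightarrow> real).
      (\<forall>n\<ge>1. signal_plus_noise (M n) S n (x n) (y n) (eps n) (f n) (\<sigma>\<^sub>\<mu> n) \<sigma>\<^sub>\<epsilon>) \<longrightarrow>
      (\<forall>n\<ge>1. \<forall>i\<in>{1..n}. prob_space.expectation (M n) (\<lambda>\<omega>. (f n (x n i \<omega>)) ^ 4) \<le> C) \<longrightarrow>
      (\<forall>n\<ge>1. measurable_estimator S n (fhat n)) \<longrightarrow>
      (\<forall>n\<ge>1. permutation_compatible S n (fhat n)) \<longrightarrow>
      (\<forall>\<^sub>F n in sequentially.
         Min ((\<lambda>\<pi>. measure (M n) {\<omega> \<in> space (M n).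
                 (\<Sum>i=1..n. (fhat n (x n i \<omega>) (sample n (x n) (y n) \<omega>) \<pi>
                            - f_perm (M n) S (x n) (y n) \<pi> i \<omega>)\<^sup>2) \<le> l n})
              ` (few_cycle_perms n \<union> {id})) \<ge> 1 - \<delta>) \<longrightarrow>
      (\<forall>\<^sub>F n in sequentially.
         (\<exists>z\<in>space S. f n z \<noteq> 0) \<and> f n \<in> \<F> \<and>
         (\<sigma>\<^sub>\<mu> n)\<^sup>2 = h * (1 / sqrt (real n) + l n / real n)) \<longrightarrow>
      liminf (\<lambda>n. ereal (measure (M n) {\<omega> \<in> space (M n).
                 perm_pvalue n (fhat n) (sample n (x n) (y n) \<omega>) \<le> \<alpha>})) > ereal \<alpha>"
proof -
  define g where "g = \<alpha> * (1 - \<alpha>)"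
  have g: "0 < g" "g < 1" "4 * \<delta> < g"
  proof -
    show "0 < g"
      using assms by (simp add: g_def)
    have "\<alpha> * (1 - \<alpha>) < 1 * 1"
      using assms by (intro mult_strict_mono) auto
    then show "g < 1"
      by (simp add: g_def)
    show "4 * \<delta> < g"
      using assms by (simp add: g_def)
  qed
  \<comment> \<open>The lower bound \<open>32\<close> makes \<open>T \<ge> 32 l\<^sub>n\<close>; the other one makes \<open>4 C / h\<^sup>2 \<le> g / 4\<close>.\<close>
  define h0 where "h0 = max 32 (sqrt (16 * \<bar>C\<bar> / g))"
  show ?thesis
  proof (rule exI[of _ h0], intro conjI allI impI)
    show "0 < h0"
      by (simp add: h0_def)
    fix h and M :: "nat \<Rightarrow> 'w measure"
      and x :: "nat \<Rightarrow> nat \<Rightarrow> 'w \<Rightarrow> 'x" and y eps :: "nat \<Rightarrow> nat \<Rightarrow> 'w \<Rightarrow> real"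
      and f :: "nat \<Rightarrow> 'x \<Rightarrow> real" and \<sigma>\<^sub>\<mu> and fhat :: "nat \<Rightarrow> 'x estimator" and l
    assume h: "h0 \<le> h"
      and model: "\<forall>n\<ge>1. signal_plus_noise (M n) S n (x n) (y n) (eps n) (f n) (\<sigma>\<^sub>\<mu> n) \<sigma>\<^sub>\<epsilon>"
      and fourth: "\<forall>n\<ge>1. \<forall>i\<in>{1..n}. prob_space.expectation (M n) (\<lambda>\<omega>. (f n (x n i \<omega>)) ^ 4) \<le> C"
      and est: "\<forall>n\<ge>1. measurable_estimator S n (fhat n)"
      and accurate: "\<forall>\<^sub>F n in sequentially.
         Min ((\<lambda>\<pi>. measure (M n) {\<omega> \<in> space (M n).
                 (\<Sum>i=1..n. (fhat n (x n i \<omega>) (sample n (x n) (y n) \<omega>) \<pi>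
                            - f_perm (M n) S (x n) (y n) \<pi> i \<omega>)\<^sup>2) \<le> l n})
              ` (few_cycle_perms n \<union> {id})) \<ge> 1 - \<delta>"
      and signal: "\<forall>\<^sub>F n in sequentially.
         (\<exists>z\<in>space S. f n z \<noteq> 0) \<and> f n \<in> \<F> \<and>
         (\<sigma>\<^sub>\<mu> n)\<^sup>2 = h * (1 / sqrt (real n) + l n / real n)"
    have h32: "32 \<le> h" and h_sqrt: "sqrt (16 * \<bar>C\<bar> / g) \<le> h"
      using h by (simp_all add: h0_def)
    have Ch: "4 * C / h\<^sup>2 \<le> g / 4"
    proof -
      have "16 * \<bar>C\<bar> / g \<le> h\<^sup>2"
        using h_sqrt by (rule sqrt_le_D)
      then have "16 * \<bar>C\<bar> \<le> g * h\<^sup>2"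
        using g by (simp add: field_simps)
      then have "16 * C \<le> g * h\<^sup>2"
        by linarith
      then show ?thesis
        using h32 by (simp add: field_simps)
    qed
    define e :: "nat \<Rightarrow> real" where "e n = 8 * (ln (real n))\<^sup>2 / real n + harm n / (ln (real n))\<^sup>2" for n
    \<comment> \<open>The mean p-value is at most \<open>g/2 + g/4 + e n\<close>, so \<open>g/8\<close> is left for \<open>e n\<close>.\<close>
    have "e \<longlonglongrightarrow> 0 + 0"
      unfolding e_def
    proof (rule tendsto_add)
      show "(\<lambda>n. 8 * (ln (real n))\<^sup>2 / real n) \<longlonglongrightarrow> 0"
        by real_asymp
    qed (rule harm_over_ln_squared_tendsto_0)
    then have "\<forall>\<^sub>F n in sequentially. e n < g / 8"
      using g by (intro order_tendstoD(2)) auto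
    then have "\<forall>\<^sub>F n in sequentially. ereal (1 - 7 / 8 * (1 - \<alpha>)) \<le>
        ereal (measure (M n) {\<omega> \<in> space (M n). perm_pvalue n (fhat n) (sample n (x n) (y n) \<omega>) \<le> \<alpha>})"
      using accurate signal eventually_ge_at_top[of 2]
    proof eventually_elim
      case (elim n)
      interpret signal_plus_noise "M n" S n "x n" "y n" "eps n" "f n" "\<sigma>\<^sub>\<mu> n" \<sigma>\<^sub>\<epsilon>
        using model elim by simp
      have fin: "finite (few_cycle_perms n \<union> {id})"
        by (auto simp: few_cycle_perms_def perms_def finite_permutations)
      have "1 - (2 * \<delta> + 4 * C / h\<^sup>2 + 8 * (ln (real n))\<^sup>2 / real n + harm n / (ln (real n))\<^sup>2) / \<alpha>
          \<le> prob {\<omega>\<in>space (M n). perm_pvalue n (fhat n) (sample n (x n) (y n) \<omega>) \<le> \<alpha>}"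
      proof (rule permutation_test_power_ge)
        fix \<pi> assume "\<pi> \<in> few_cycle_perms n \<union> {id}"
        then show "1 - \<delta> \<le> prob {\<omega> \<in> space (M n).
                 (\<Sum>i=1..n. (fhat n (x n i \<omega>) (sample n (x n) (y n) \<omega>) \<pi>
                            - f_perm (M n) S (x n) (y n) \<pi> i \<omega>)\<^sup>2) \<le> l n}"
          using elim(2) fin by auto
      qed (use elim assms g h32 est fourth in auto)
      moreover have "(2 * \<delta> + 4 * C / h\<^sup>2 + 8 * (ln (real n))\<^sup>2 / real n + harm n / (ln (real n))\<^sup>2) / \<alpha>
          \<le> (7 / 8 * g) / \<alpha>"
        using elim(1) Ch g assms unfolding e_def by (intro divide_right_mono) linarith+
      moreover have "(7 / 8 * g) / \<alpha> = 7 / 8 * (1 - \<alpha>)"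
        using assms by (simp add: g_def)
      ultimately show ?case
        unfolding ereal_less_eq by linarith
    qed
    then have "ereal (1 - 7 / 8 * (1 - \<alpha>)) \<le> liminf (\<lambda>n. ereal (measure (M n) {\<omega> \<in> space (M n).
        perm_pvalue n (fhat n) (sample n (x n) (y n) \<omega>) \<le> \<alpha>}))"
      by (rule Liminf_bounded)
    moreover have "ereal \<alpha> < ereal (1 - 7 / 8 * (1 - \<alpha>))"
      using assms(2) by (simp add: field_simps)
    ultimately show "liminf (\<lambda>n. ereal (measure (M n) {\<omega> \<in> space (M n).
        perm_pvalue n (fhat n) (sample n (x n) (y n) \<omega>) \<le> \<alpha>})) > ereal \<alpha>"
      by (rule less_le_trans[rotated])
  qed
qed

end
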